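(* Let $H$ be an $n\times n$ Hermitian matrix ($n\ge2$) with eigenvalues $\lambda_0\le\lambda_1\le\dots\le\lambda_{n-1}$, spectral gap $\gamma=\lambda_1-\lambda_0$, and ground-state $\phi_0$ (an eigenvector for $\lambda_0$). Let $U=\mathrm{diag}(\phi_0/|\phi_0|)$, and let $h$ be the weighted Cheeger constant of $H$, formed from $\mathrm{Re}(U^\dagger HU)$ and $|\phi_0|$. Then $$2h\ \ge\ \gamma .$$
   Context: The ratio and absolute value in $\phi_0/|\phi_0|$ are taken entrywise (with the value $1$ where $\phi_0$ vanishes), so $U$ is a diagonal unitary matrix and $U^\dagger\phi_0=|\phi_0|\ge0$. $\mathrm{Re}(M)$ is the entrywise real part. Write the real symmetric matrix $\mathrm{Re}(U^\dagger HU)=L+W$, where $W$ is a real diagonal matrix and $L$ is either the combinatorial or the normalized Laplacian of a connected weighted graph $G=(V,E)$ on $V=\{1,\dots,n\}$ with symmetric real weights $w_{uv}$ (possibly negative, $w_{uv}=0$ if $\{u,v\}\notin E$). Here $d_u=\sum_v w_{uv}$; the combinatorial Laplacian has entries $L(u,u)=d_u$, $L(u,v)=-w_{uv}$ ($u\ne v$); the normalized Laplacian (for which all $d_u>0$) has entries $\mathcal L(u,u)=1$, $\mathcal L(u,v)=-w_{uv}/\sqrt{d_ud_v}$ ($u\neq v$). Put $q_u=1$ and $\phi=|\phi_0|$ in the combinatorial case, and $q_u=d_u$ and $\phi(u)=|\phi_0(u)|/\sqrt{d_u}$ in the normalized case. For $S\subset V$ with complement $\overline S$, let $|\partial S|=\sum_{u\in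 S,v\in\overline S}w_{uv}\phi(u)\phi(v)$ and $\mathrm{vol}(S)=\sum_{u\in S}q_u\phi^2(u)$. The weighted Cheeger constant is $$h=\min_{S}\frac{|\partial S|}{\min\{\mathrm{vol}(S),\mathrm{vol}(\overline S)\}},$$ the minimum being over $S\subset V$ with $\mathrm{vol}(S)>0$ and $\mathrm{vol}(\overline S)>0$. *)

theory Defs
  imports
    "Jordan_Normal_Form.Schur_Decomposition"
    "HOL-Library.Extended_Real"
begin

definition hermitian_mat :: "complex mat \<Rightarrow> bool" where
  "hermitian_mat H \<longleftrightarrow> mat_adjoint H = H"

(* The eigenvalues of an n x n matrix, counted with multiplicity (as roots of the
   characteristic polynomial) and listed in nondecreasing order. *)
definition ordered_eigenvalues :: "nat \<Rightarrow> complex mat \<Rightarrow> (nat \<Rightarrow> real) \<Rightarrow> bool" where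
  "ordered_eigenvalues n H lam \<longleftrightarrow>
     mono_on {..<n} lam \<and> char_poly H = (\<Prod>i<n. [:- complex_of_real (lam i), 1:])"

definition phase :: "complex \<Rightarrow> complex" where
  "phase z = (if z = 0 then 1 else z / complex_of_real (cmod z))"

definition phase_mat :: "nat \<Rightarrow> complex vec \<Rightarrow> complex mat" where
  "phase_mat n \<phi>\<^sub>0 = mat_diag n (\<lambda>i. phase (\<phi>\<^sub>0 $ i))"

(* Vertices are 0, ..., n - 1.  An edge may carry weight 0; edges are not loops, so that
   w u u = 0. *)
definition connected_weighted_graph ::
    "nat \<Rightarrow> nat set set \<Rightarrow> (nat \<Rightarrow> nat \<Rightarrow> real) \<Rightarrow> bool" where
  "connected_weighted_graph n E w \<longleftrightarrow>
     E \<subseteq> {{u, v} | u v. u < n \<and> v < n \<and> u \<noteq> v} \<and>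
     (\<forall>u<n. \<forall>v<n. w u v = w v u) \<and>
     (\<forall>u<n. \<forall>v<n. {u, v} \<notin> E \<longrightarrow> w u v = 0) \<and>
     (\<forall>u<n. \<forall>v<n. (u, v) \<in> {(x, y). {x, y} \<in> E}\<^sup>*)"

definition wdegree :: "nat \<Rightarrow> (nat \<Rightarrow> nat \<Rightarrow> real) \<Rightarrow> nat \<Rightarrow> real" where
  "wdegree n w u = (\<Sum>v<n. w u v)"

datatype laplacian_kind = Combinatorial | Normalized

fun laplacian :: "laplacian_kind \<Rightarrow> nat \<Rightarrow> (nat \<Rightarrow> nat \<Rightarrow> real) \<Rightarrow> real mat" where
  "laplacian Combinatorial n w =
     mat n n (\<lambda>(u, v). if u = v then wdegree n w u else - w u v)"
| "laplacian Normalized n w =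
     mat n n (\<lambda>(u, v). if u = v then 1 else - w u v / sqrt (wdegree n w u * wdegree n w v))"

fun vertex_weight :: "laplacian_kind \<Rightarrow> nat \<Rightarrow> (nat \<Rightarrow> nat \<Rightarrow> real) \<Rightarrow> nat \<Rightarrow> real" where
  "vertex_weight Combinatorial n w u = 1"
| "vertex_weight Normalized n w u = wdegree n w u"

fun scaled_modulus ::
    "laplacian_kind \<Rightarrow> nat \<Rightarrow> (nat \<Rightarrow> nat \<Rightarrow> real) \<Rightarrow> complex vec \<Rightarrow> nat \<Rightarrow> real" where
  "scaled_modulus Combinatorial n w \<phi>\<^sub>0 u = cmod (\<phi>\<^sub>0 $ u)"
| "scaled_modulus Normalized n w \<phi>\<^sub>0 u = cmod (\<phi>\<^sub>0 $ u) / sqrt (wdegree n w u)"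

definition boundary ::
    "nat \<Rightarrow> (nat \<Rightarrow> nat \<Rightarrow> real) \<Rightarrow> (nat \<Rightarrow> real) \<Rightarrow> nat set \<Rightarrow> real" where
  "boundary n w \<phi> S = (\<Sum>u\<in>S. \<Sum>v\<in>{..<n} - S. w u v * \<phi> u * \<phi> v)"

definition vol :: "(nat \<Rightarrow> real) \<Rightarrow> (nat \<Rightarrow> real) \<Rightarrow> nat set \<Rightarrow> real" where
  "vol q \<phi> S = (\<Sum>u\<in>S. q u * (\<phi> u)\<^sup>2)"

(* A minimum over finitely many S, written as an infimum in the extended reals: if \<phi> is
   supported on a single vertex, then no S is admissible and the value is \<infinity>. *)
definition cheeger ::
    "nat \<Rightarrow> (nat \<Rightarrow> nat \<Rightarrow> real) \<Rightarrow> (nat \<Rightarrow> real) \<Rightarrow> (nat \<Rightarrow> real) \<Rightarrow> ereal" where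
  "cheeger n w q \<phi> =
     (INF S \<in> {S. S \<subseteq> {..<n} \<and> vol q \<phi> S > 0 \<and> vol q \<phi> ({..<n} - S) > 0}.
        ereal (boundary n w \<phi> S / min (vol q \<phi> S) (vol q \<phi> ({..<n} - S))))"

end

theory Submission imports Defs begin

text \<open>
The spectral gap is estimated from above by the variational principle: every vector orthogonal to
a ground state of a Hermitian matrix has Rayleigh quotient at least \<open>lam 1\<close>
(\<open>hermitian_form_ge_second_eigenvalue\<close>).  This rests on splitting off one eigenvector at a time
(\<open>hermitian_deflation\<close>), which divides the characteristic polynomial by one linear factor.

Conjugating by \<open>U\<close> makes the ground state the nonnegative vector \<open>\<psi>\<close> of its moduli.  Both the
eigenvalue equation for a real vector and the quadratic form on real vectors only see the real
part \<open>R\<close> of the conjugated matrix, so \<open>R\<close> has \<open>\<psi>\<close> as an eigenvector for \<open>lam 0\<close>, and on real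
vectors orthogonal to \<open>\<psi>\<close> its form is at least \<open>lam 1\<close> times the squared norm.

For a set \<open>S\<close> the test vector is \<open>\<psi>\<close> times a function that takes one value on \<open>S\<close> and another off
\<open>S\<close>.  By the ground state representation of the form (\<open>ground_state_representation\<close>), its energy above
\<open>lam 0\<close> comes only from pairs of vertices on different sides, with the weights
\<open>- R u v * \<psi> u * \<psi> v\<close> that make up \<open>boundary\<close>.  Orthogonality to \<open>\<psi>\<close> fixes the ratio of the two
values, and the result is \<open>\<gamma> \<le> (1 / vol S + 1 / vol S') * boundary S\<close> with \<open>S'\<close> the complement of
\<open>S\<close> (\<open>gap_le_cut\<close>), hence \<open>\<gamma> \<le> 2 * boundary S / min (vol S) (vol S')\<close>.
\<close>

section \<open>Adjoints and Hermitian quadratic forms\<close>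

lemma mat_adjoint_carrier: "A \<in> carrier_mat m n \<Longrightarrow> mat_adjoint A \<in> carrier_mat n m"
  by (auto simp: mat_adjoint_def)

lemma mat_adjoint_dim [simp]:
  "dim_row (mat_adjoint A) = dim_col A" "dim_col (mat_adjoint A) = dim_row A"
  by (auto simp: mat_adjoint_def)

lemma mat_adjoint_index:
  "i < dim_col A \<Longrightarrow> j < dim_row A \<Longrightarrow> mat_adjoint A $$ (i, j) = conjugate (A $$ (j, i))"
  by (simp add: mat_adjoint_def mat_of_rows_index)

lemma row_mat_adjoint: "i < dim_col A \<Longrightarrow> row (mat_adjoint A) i = conjugate (col A i)"
  by (intro eq_vecI) (auto simp: mat_adjoint_index)

lemma mat_adjoint_adjoint: "A \<in> carrier_mat m n \<Longrightarrow> mat_adjoint (mat_adjoint A) = A"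
  using mat_adjoint_carrier[of A m n] mat_adjoint_carrier[of "mat_adjoint A" n m]
  by (intro eq_matI) (auto simp: mat_adjoint_index)

lemma mat_adjoint_mult:
  fixes A B :: "complex mat"
  assumes A: "A \<in> carrier_mat l m" and B: "B \<in> carrier_mat m n"
  shows "mat_adjoint (A * B) = mat_adjoint B * mat_adjoint A"
proof -
  have AB: "A * B \<in> carrier_mat l n" using A B by auto
  show ?thesis
    using A B mat_adjoint_carrier[OF A] mat_adjoint_carrier[OF B] mat_adjoint_carrier[OF AB]
    by (intro eq_matI) (auto simp: mat_adjoint_index scalar_prod_def mult.commute)
qed

lemma cscalar_prod_sum:
  fixes x y :: "complex vec"
  assumes "x \<in> carrier_vec n" "y \<in> carrier_vec n"
  shows "x \<bullet>c y = (\<Sum>i<n. x $ i * cnj (y $ i))"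
  using assms by (auto simp: scalar_prod_def lessThan_atLeast0)

lemma mult_mat_vec_sum:
  fixes x :: "complex vec"
  assumes "A \<in> carrier_mat m n" "x \<in> carrier_vec n" "i < m"
  shows "(A *\<^sub>v x) $ i = (\<Sum>j<n. A $$ (i, j) * x $ j)"
  using assms by (auto simp: scalar_prod_def lessThan_atLeast0)

lemma cscalar_prod_adjoint:
  fixes A :: "complex mat"
  assumes A: "A \<in> carrier_mat m n" and x: "x \<in> carrier_vec n" and y: "y \<in> carrier_vec m"
  shows "(A *\<^sub>v x) \<bullet>c y = x \<bullet>c (mat_adjoint A *\<^sub>v y)"
proof -
  have A': "mat_adjoint A \<in> carrier_mat n m" using A by (rule mat_adjoint_carrier)
  have "(A *\<^sub>v x) \<bullet>c y = (\<Sum>i<m. \<Sum>j<n. A $$ (i, j) * x $ j * cnj (y $ i))"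
    using A x y by (simp add: cscalar_prod_sum[of _ m] mult_mat_vec_sum[OF A x] sum_distrib_right
        del: index_mult_mat_vec)
  also have "\<dots> = (\<Sum>j<n. \<Sum>i<m. A $$ (i, j) * x $ j * cnj (y $ i))"
    by (rule sum.swap)
  also have "\<dots> = x \<bullet>c (mat_adjoint A *\<^sub>v y)"
    using A A' x y
    by (auto simp: cscalar_prod_sum[of _ n] mult_mat_vec_sum[OF A' y] sum_distrib_left
        mat_adjoint_index ac_simps simp del: index_mult_mat_vec intro!: sum.cong)
  finally show ?thesis .
qed

lemma quadratic_form_sum:
  fixes A :: "complex mat"
  assumes A: "A \<in> carrier_mat n n" and x: "x \<in> carrier_vec n"
  shows "(A *\<^sub>v x) \<bullet>c x = (\<Sum>i<n. \<Sum>j<n. A $$ (i, j) * x $ j * cnj (x $ i))"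
  using A x by (simp add: cscalar_prod_sum[of _ n] mult_mat_vec_sum[OF A x] sum_distrib_right
        del: index_mult_mat_vec)

lemma hermitian_mat_index:
  assumes "A \<in> carrier_mat n n" and "hermitian_mat A" and "i < n" "j < n"
  shows "A $$ (j, i) = cnj (A $$ (i, j))"
  using assms mat_adjoint_index[of j A i] unfolding hermitian_mat_def by auto

lemma hermitian_matI:
  assumes A: "A \<in> carrier_mat n n"
    and sym: "\<And>i j. i < n \<Longrightarrow> j < n \<Longrightarrow> A $$ (j, i) = cnj (A $$ (i, j))"
  shows "hermitian_mat A"
  unfolding hermitian_mat_def
proof (rule eq_matI)
  fix i j assume "i < dim_row A" "j < dim_col A"
  then show "mat_adjoint A $$ (i, j) = A $$ (i, j)"
    using A sym[of j i] by (simp add: mat_adjoint_index)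
qed (use A in simp_all)

section \<open>Eigenvalues and Hermitian quadratic forms\<close>

text \<open>Gram-Schmidt applied to a basis that starts with \<open>v\<close> gives columns that are orthogonal but not
of length one.  They are rescaled here because conjugation by a matrix with merely orthogonal
columns would not preserve hermiticity, which the deflation step below depends on.\<close>

lemma unitary_completion:
  fixes v :: "complex vec"
  assumes v: "v \<in> carrier_vec n" and v0: "v \<noteq> 0\<^sub>v n"
  obtains W c where "W \<in> carrier_mat n n" "mat_adjoint W * W = 1\<^sub>m n" "col W 0 = c \<cdot>\<^sub>v v" "c \<noteq> 0"
proof -
  interpret cof_vec_space n "TYPE(complex)" .
  define b where "b = basis_completion v"
  define ws where "ws = gram_schmidt n b"
  note bc = basis_completion[OF v v0, folded b_def]
  have n: "n \<noteq> 0" using v v0 by auto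
  obtain vs where bv: "b = v # vs" using bc(6,7) n by (cases b) auto
  have ws: "set ws \<subseteq> carrier_vec n" "corthogonal ws" "length ws = n"
    using gram_schmidt_result[OF bc(2,4,5) refl, folded ws_def] bc(6) by auto
  have "List.hd ws = v"
    unfolding ws_def bv by (rule gram_schmidt_hd[OF v])
  moreover have "ws \<noteq> []" using ws(3) n by auto
  ultimately have hd: "ws ! 0 = v" by (simp add: hd_conv_nth)
  have wsc: "ws ! i \<in> carrier_vec n" if "i < n" for i
    using ws that by auto
  define r where "r i = sqrt (Re (ws ! i \<bullet>c ws ! i))" for i
  have sq: "ws ! i \<bullet>c ws ! i = complex_of_real (r i) * complex_of_real (r i)"
    and r0: "r i \<noteq> 0" if i: "i < n" for i
  proof -
    have "ws ! i \<bullet>c ws ! i \<ge> 0" by (intro conjugate_square_ge_0_vec wsc i)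
    moreover have "ws ! i \<bullet>c ws ! i \<noteq> 0" using corthogonalD[OF ws(2)] i ws(3) by auto
    ultimately have pos: "Re (ws ! i \<bullet>c ws ! i) > 0" and im: "Im (ws ! i \<bullet>c ws ! i) = 0"
      unfolding less_eq_complex_def complex_eq_iff by simp_all
    then have "r i * r i = Re (ws ! i \<bullet>c ws ! i)" by (simp add: r_def)
    then show "ws ! i \<bullet>c ws ! i = complex_of_real (r i) * complex_of_real (r i)"
      using im by (simp add: complex_eq_iff)
    show "r i \<noteq> 0" using pos by (simp add: r_def)
  qed
  define us where "us = map (\<lambda>i. complex_of_real (1 / r i) \<cdot>\<^sub>v ws ! i) [0..<n]"
  define W where "W = mat_of_cols n us"
  have W: "W \<in> carrier_mat n n" using mat_of_cols_carrier(1)[of n us] by (simp add: W_def us_def)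
  have colW: "col W i = complex_of_real (1 / r i) \<cdot>\<^sub>v ws ! i" if "i < n" for i
    using that wsc unfolding W_def by (subst col_mat_of_cols) (auto simp: us_def)
  have "mat_adjoint W * W = 1\<^sub>m n"
  proof (rule eq_matI)
    fix i j assume "i < dim_row (1\<^sub>m n :: complex mat)" "j < dim_col (1\<^sub>m n :: complex mat)"
    then have i: "i < n" and j: "j < n" by auto
    have "(mat_adjoint W * W) $$ (i, j) = conjugate (col W i) \<bullet> col W j"
      using W i j by (simp add: row_mat_adjoint)
    also have "\<dots> = col W j \<bullet>c col W i"
      using W i j by (intro comm_scalar_prod[of _ n]) auto
    also have "\<dots> = of_real (1 / r j) * of_real (1 / r i) * (ws ! j \<bullet>c ws ! i)"
      using wsc[OF i] wsc[OF j]
      by (simp add: colW i j conjugate_smult_vec)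
    also have "\<dots> = 1\<^sub>m n $$ (i, j)"
    proof (cases "i = j")
      case True
      then show ?thesis using i r0[OF i] by (simp add: sq)
    next
      case False
      then have "ws ! j \<bullet>c ws ! i = 0"
        using corthogonalD[OF ws(2), of j i] ws(3) i j by simp
      then show ?thesis using False i j by simp
    qed
    finally show "(mat_adjoint W * W) $$ (i, j) = 1\<^sub>m n $$ (i, j)" .
  qed (use W in simp_all)
  moreover have "col W 0 = complex_of_real (1 / r 0) \<cdot>\<^sub>v v"
    using colW[of 0] n by (simp add: hd)
  moreover have "complex_of_real (1 / r 0) \<noteq> 0" using r0[of 0] n by simp
  ultimately show thesis by (rule that[OF W])
qed

text \<open>In an orthonormal basis whose first vector is proportional to \<open>v\<close>, the first column of \<open>A\<close> is
\<open>e\<close> times the first unit vector; hermiticity then clears the first row as well, so \<open>A\<close> splits as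
\<open>e \<oplus> B\<close>.  The change of basis itself is hidden: all that is used later is how the characteristic
polynomial and the quadratic forms split, where \<open>a\<close> is the coordinate of \<open>x\<close> along \<open>v\<close>, and \<open>y\<close>
collects the remaining ones.\<close>

lemma hermitian_deflation:
  assumes A: "A \<in> carrier_mat (Suc n) (Suc n)" and herm: "hermitian_mat A"
    and ev: "eigenvector A v e"
  obtains B where "B \<in> carrier_mat n n" "hermitian_mat B"
    "char_poly A = [:- e, 1:] * char_poly B"
    "\<And>x. x \<in> carrier_vec (Suc n) \<Longrightarrow> \<exists>a y. y \<in> carrier_vec n \<and>
       x \<bullet>c x = a * cnj a + y \<bullet>c y \<and>
       (A *\<^sub>v x) \<bullet>c x = e * (a * cnj a) + (B *\<^sub>v y) \<bullet>c y \<and>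
       (x \<bullet>c v = 0 \<longrightarrow> a = 0)"
proof -
  let ?N = "Suc n"
  have v: "v \<in> carrier_vec ?N" and v0: "v \<noteq> 0\<^sub>v ?N" and Av: "A *\<^sub>v v = e \<cdot>\<^sub>v v"
    using ev A unfolding eigenvector_def by auto
  obtain W c where W: "W \<in> carrier_mat ?N ?N" and W'W: "mat_adjoint W * W = 1\<^sub>m ?N"
    and W0: "col W 0 = c \<cdot>\<^sub>v v" and c: "c \<noteq> 0"
    using unitary_completion[OF v v0] by metis
  define W' where "W' = mat_adjoint W"
  have W': "W' \<in> carrier_mat ?N ?N" unfolding W'_def using W by (rule mat_adjoint_carrier)
  have W'W: "W' * W = 1\<^sub>m ?N" using W'W by (simp add: W'_def)
  have WW': "W * W' = 1\<^sub>m ?N" using mat_mult_left_right_inverse[OF W' W W'W] .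
  define C where "C = W' * A * W"
  have C: "C \<in> carrier_mat ?N ?N" unfolding C_def using A W W' by auto
  have W'adj: "mat_adjoint W' = W" unfolding W'_def using W by (rule mat_adjoint_adjoint)
  have Cform: "(C *\<^sub>v y) \<bullet>c y = (A *\<^sub>v (W *\<^sub>v y)) \<bullet>c (W *\<^sub>v y)"
    if y: "y \<in> carrier_vec ?N" for y
  proof -
    have "C *\<^sub>v y = W' *\<^sub>v (A *\<^sub>v (W *\<^sub>v y))"
      unfolding C_def using A W W' y by (simp add: assoc_mult_mat_vec[of _ ?N ?N _ ?N])
    then show ?thesis
      using cscalar_prod_adjoint[OF W', of "A *\<^sub>v (W *\<^sub>v y)" y] A W y by (simp add: W'adj)
  qed
  have "hermitian_mat C"
  proof -
    have "mat_adjoint C = mat_adjoint W * (mat_adjoint A * mat_adjoint W')"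
      unfolding C_def
      by (simp only: mat_adjoint_mult[OF mult_carrier_mat[OF W' A] W] mat_adjoint_mult[OF W' A])
    also have "\<dots> = W' * (A * W)"
      using herm by (simp only: W'adj hermitian_mat_def flip: W'_def)
    also have "\<dots> = C"
      unfolding C_def by (rule assoc_mult_mat[OF W' A W, symmetric])
    finally show ?thesis unfolding hermitian_mat_def .
  qed
  note Cherm = hermitian_mat_index[OF C this]
  have C0: "C $$ (i, 0) = (if i = 0 then e else 0)" if i: "i < ?N" for i
  proof -
    have "A *\<^sub>v col W 0 = e \<cdot>\<^sub>v col W 0"
      using A v unfolding W0 by (simp add: mult_mat_vec[of _ ?N ?N] Av smult_smult_assoc mult.commute)
    moreover have "col C 0 = W' *\<^sub>v (A *\<^sub>v col W 0)"
      unfolding C_def using col_mult2[OF mult_carrier_mat[OF W' A] W, of 0]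
        assoc_mult_mat_vec[OF W' A col_carrier_vec[OF _ W], of 0] by simp
    ultimately have "col C 0 = W' *\<^sub>v (e \<cdot>\<^sub>v col W 0)" by simp
    also have "\<dots> = e \<cdot>\<^sub>v col (W' * W) 0"
      using W W' mult_mat_vec[OF W' col_carrier_vec[OF _ W], of 0 e] col_mult2[OF W' W, of 0] by simp
    finally have "col C 0 $ i = (e \<cdot>\<^sub>v col (1\<^sub>m ?N) 0) $ i" by (simp only: W'W)
    then show ?thesis using C i by simp
  qed
  define B where "B = mat n n (\<lambda>(i, j). C $$ (Suc i, Suc j))"
  have B: "B \<in> carrier_mat n n" by (simp add: B_def)
  have C0': "C $$ (0, j) = (if j = 0 then e else 0)" if j: "j < ?N" for j
  proof -
    have "C $$ (0, j) = cnj (C $$ (j, 0))" by (rule Cherm[OF j]) simp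
    then show ?thesis
      unfolding C0[OF j] by (cases "j = 0") (simp_all add: C0)
  qed
  have hB: "hermitian_mat B"
  proof (rule hermitian_matI[OF B])
    fix i j assume "i < n" "j < n"
    then show "B $$ (j, i) = cnj (B $$ (i, j))"
      unfolding B_def using Cherm[of "Suc i" "Suc j"] by simp
  qed
  have Cblock: "C = four_block_mat (mat 1 1 (\<lambda>_. e)) (0\<^sub>m 1 n) (0\<^sub>m n 1) B"
    using C C0 C0' by (intro eq_matI) (auto simp: B_def)
  have "char_poly A = char_poly C"
  proof (rule char_poly_similar)
    have "similar_mat_wit C A W' W"
      by (rule similar_mat_witI[of _ _ ?N]) (use W W' A C W'W WW' in \<open>auto simp: C_def\<close>)
    then have "similar_mat C A" unfolding similar_mat_def by blast
    then show "similar_mat A C" by (rule similar_mat_sym)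
  qed
  also have "\<dots> = char_poly (mat 1 1 (\<lambda>_. e)) * char_poly B"
    unfolding Cblock by (rule char_poly_four_block_zeros_col) (use B in auto)
  also have "char_poly (mat 1 1 (\<lambda>_. e)) = [:- e, 1:]"
    by (simp add: char_poly_defs det_def sign_def)
  finally have cp: "char_poly A = [:- e, 1:] * char_poly B" .
  have "\<exists>a y. y \<in> carrier_vec n \<and> x \<bullet>c x = a * cnj a + y \<bullet>c y \<and>
       (A *\<^sub>v x) \<bullet>c x = e * (a * cnj a) + (B *\<^sub>v y) \<bullet>c y \<and> (x \<bullet>c v = 0 \<longrightarrow> a = 0)"
    if x: "x \<in> carrier_vec ?N" for x
  proof -
    define z where "z = W' *\<^sub>v x"
    have z: "z \<in> carrier_vec ?N" using W' x by (auto simp: z_def)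
    have Wz: "W *\<^sub>v z = x"
      unfolding z_def using assoc_mult_mat_vec[OF W W' x] x by (simp add: WW')
    define y where "y = vec n (\<lambda>i. z $ Suc i)"
    have y: "y \<in> carrier_vec n" by (simp add: y_def)
    have "x \<bullet>c x = z \<bullet>c z"
      using cscalar_prod_adjoint[OF W z x] by (simp add: Wz W'_def[symmetric] z_def[symmetric])
    also have "\<dots> = z $ 0 * cnj (z $ 0) + y \<bullet>c y"
      by (simp only: cscalar_prod_sum[OF z z] cscalar_prod_sum[OF y y] sum.lessThan_Suc_shift)
         (simp add: y_def)
    finally have 1: "x \<bullet>c x = z $ 0 * cnj (z $ 0) + y \<bullet>c y" .
    have "(A *\<^sub>v x) \<bullet>c x = (C *\<^sub>v z) \<bullet>c z" using Cform[OF z] Wz by simp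
    also have "\<dots> = e * (z $ 0 * cnj (z $ 0)) + (B *\<^sub>v y) \<bullet>c y"
      by (simp only: quadratic_form_sum[OF C z] quadratic_form_sum[OF B y] sum.lessThan_Suc_shift)
         (simp add: y_def B_def C0 C0')
    finally have 2: "(A *\<^sub>v x) \<bullet>c x = e * (z $ 0 * cnj (z $ 0)) + (B *\<^sub>v y) \<bullet>c y" .
    have "z $ 0 = conjugate (col W 0) \<bullet> x"
      using W W' x by (simp add: z_def W'_def row_mat_adjoint)
    also have "\<dots> = cnj c * (x \<bullet>c v)"
      using v x by (simp add: W0 conjugate_smult_vec comm_scalar_prod[of "conjugate v" ?N x])
    finally have 3: "x \<bullet>c v = 0 \<longrightarrow> z $ 0 = 0" by simp
    show ?thesis using y 1 2 3 by blast
  qed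
  then show thesis by (rule that[OF B hB cp])
qed

text \<open>The root \<open>\<mu> n\<close> of the characteristic polynomial has an eigenvector; deflating by it leaves a
Hermitian matrix of size \<open>n\<close> whose characteristic polynomial is the product of the other factors.\<close>

lemma hermitian_form_ge_least_eigenvalue:
  assumes "A \<in> carrier_mat n n" and "hermitian_mat A"
    and "char_poly A = (\<Prod>i<n. [:- complex_of_real (\<mu> i), 1:])"
    and "\<And>i. i < n \<Longrightarrow> c \<le> \<mu> i"
    and "x \<in> carrier_vec n"
  shows "c * Re (x \<bullet>c x) \<le> Re ((A *\<^sub>v x) \<bullet>c x)"
  using assms
proof (induction n arbitrary: A x)
  case 0
  then show ?case by (simp add: cscalar_prod_sum[of _ 0])
next
  case (Suc n)
  have "eigenvalue A (of_real (\<mu> n))"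
    unfolding eigenvalue_root_char_poly[OF Suc.prems(1)] Suc.prems(3) by (simp add: poly_prod)
  then obtain v where ev: "eigenvector A v (of_real (\<mu> n))" unfolding eigenvalue_def by blast
  obtain B where B: "B \<in> carrier_mat n n" "hermitian_mat B"
    and cp: "char_poly A = [:- of_real (\<mu> n), 1:] * char_poly B"
    and split: "\<And>x. x \<in> carrier_vec (Suc n) \<Longrightarrow> \<exists>a y. y \<in> carrier_vec n \<and>
       x \<bullet>c x = a * cnj a + y \<bullet>c y \<and>
       (A *\<^sub>v x) \<bullet>c x = of_real (\<mu> n) * (a * cnj a) + (B *\<^sub>v y) \<bullet>c y \<and>
       (x \<bullet>c v = 0 \<longrightarrow> a = 0)"
    using hermitian_deflation[OF Suc.prems(1,2) ev] by metis
  have "[:- of_real (\<mu> n), 1:] * char_poly B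
      = [:- of_real (\<mu> n), 1:] * (\<Prod>i<n. [:- complex_of_real (\<mu> i), 1:])"
    using cp Suc.prems(3) by (simp only: prod.lessThan_Suc mult.commute)
  then have cpB: "char_poly B = (\<Prod>i<n. [:- complex_of_real (\<mu> i), 1:])"
    by (metis mult_cancel_left pCons_eq_0_iff zero_neq_one)
  obtain a y where y: "y \<in> carrier_vec n" and x: "x \<bullet>c x = a * cnj a + y \<bullet>c y"
    and Ax: "(A *\<^sub>v x) \<bullet>c x = of_real (\<mu> n) * (a * cnj a) + (B *\<^sub>v y) \<bullet>c y"
    using split[OF Suc.prems(5)] by blast
  have "c * Re (y \<bullet>c y) \<le> Re ((B *\<^sub>v y) \<bullet>c y)"
    using Suc.IH[OF B cpB _ y] Suc.prems(4) by simp
  moreover have "c * (cmod a)\<^sup>2 \<le> \<mu> n * (cmod a)\<^sup>2"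
    using Suc.prems(4)[of n] by (simp add: mult_right_mono)
  moreover have "a * cnj a = of_real ((cmod a)\<^sup>2)"
    by (rule complex_norm_square[symmetric])
  ultimately show ?case
    unfolding x Ax by (simp only: plus_complex.sel Re_complex_of_real distrib_left flip: of_real_mult)
qed

text \<open>Deflation by the ground state removes exactly one factor of the characteristic polynomial, so
the eigenvalues of what remains are \<open>lam 1, lam 2, \<dots>\<close>, all at least \<open>lam 1\<close>.  Since multiplicities
are counted by the characteristic polynomial, a degenerate ground state needs no separate
treatment and \<open>v\<close> may be any of its eigenvectors.\<close>

lemma hermitian_form_ge_second_eigenvalue:
  assumes H: "H \<in> carrier_mat n n" and herm: "hermitian_mat H"
    and eigs: "ordered_eigenvalues n H lam"
    and ev: "eigenvector H v (complex_of_real (lam 0))"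
    and n: "n \<ge> 2"
    and x: "x \<in> carrier_vec n" and orth: "x \<bullet>c v = 0"
  shows "lam 1 * Re (x \<bullet>c x) \<le> Re ((H *\<^sub>v x) \<bullet>c x)"
proof -
  obtain m where m: "n = Suc m" using n by (cases n) auto
  obtain B where B: "B \<in> carrier_mat m m" "hermitian_mat B"
    and cp: "char_poly H = [:- of_real (lam 0), 1:] * char_poly B"
    and split: "\<And>x. x \<in> carrier_vec n \<Longrightarrow> \<exists>a y. y \<in> carrier_vec m \<and>
       x \<bullet>c x = a * cnj a + y \<bullet>c y \<and>
       (H *\<^sub>v x) \<bullet>c x = of_real (lam 0) * (a * cnj a) + (B *\<^sub>v y) \<bullet>c y \<and>
       (x \<bullet>c v = 0 \<longrightarrow> a = 0)"
    using hermitian_deflation[OF H[unfolded m] herm ev] unfolding m by metis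
  have "[:- of_real (lam 0), 1:] * char_poly B
      = [:- of_real (lam 0), 1:] * (\<Prod>i<m. [:- complex_of_real (lam (Suc i)), 1:])"
    using cp eigs unfolding ordered_eigenvalues_def m by (simp only: prod.lessThan_Suc_shift)
  then have cpB: "char_poly B = (\<Prod>i<m. [:- complex_of_real (lam (Suc i)), 1:])"
    by (metis mult_cancel_left pCons_eq_0_iff zero_neq_one)
  obtain y where y: "y \<in> carrier_vec m" "x \<bullet>c x = y \<bullet>c y" "(H *\<^sub>v x) \<bullet>c x = (B *\<^sub>v y) \<bullet>c y"
    using split[OF x] orth by auto
  have "lam 1 \<le> lam (Suc i)" if "i < m" for i
    using eigs that n unfolding ordered_eigenvalues_def m by (auto intro: mono_onD)
  then show ?thesis
    using hermitian_form_ge_least_eigenvalue[OF B cpB _ y(1)] y by simp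
qed

section \<open>Test functions constant on both sides of a cut\<close>

text \<open>Writing a test function as \<open>\<psi> g\<close>, the eigenvalue equation turns each of the two sums obtained from
\<open>(g u)\<^sup>2\<close> and \<open>(g v)\<^sup>2\<close> in the expanded square into \<open>l\<close> times the squared norm.  The diagonal
of \<open>R\<close> drops out on the right, so that only interactions between distinct vertices remain.\<close>

lemma ground_state_representation:
  fixes R :: "nat \<Rightarrow> nat \<Rightarrow> real"
  assumes sym: "\<And>u v. u < n \<Longrightarrow> v < n \<Longrightarrow> R u v = R v u"
    and eig: "\<And>u. u < n \<Longrightarrow> (\<Sum>v<n. R u v * \<psi> v) = l * \<psi> u"
  shows "(\<Sum>u<n. \<Sum>v<n. R u v * (\<psi> u * g u) * (\<psi> v * g v)) - l * (\<Sum>u<n. (\<psi> u * g u)\<^sup>2)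
    = (\<Sum>u<n. \<Sum>v<n. - R u v * \<psi> u * \<psi> v * (g u - g v)\<^sup>2) / 2"
proof -
  let ?d = "\<Sum>u<n. \<Sum>v<n. R u v * \<psi> u * \<psi> v * (g u)\<^sup>2"
  let ?x = "\<Sum>u<n. \<Sum>v<n. R u v * (\<psi> u * g u) * (\<psi> v * g v)"
  have "?d = (\<Sum>u<n. \<psi> u * (g u)\<^sup>2 * (\<Sum>v<n. R u v * \<psi> v))"
    by (simp add: sum_distrib_left ac_simps)
  also have "\<dots> = (\<Sum>u<n. \<psi> u * (g u)\<^sup>2 * (l * \<psi> u))"
    by (intro sum.cong refl) (simp add: eig)
  also have "\<dots> = l * (\<Sum>u<n. (\<psi> u * g u)\<^sup>2)"
    by (simp add: sum_distrib_left power2_eq_square ac_simps)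
  finally have d: "?d = l * (\<Sum>u<n. (\<psi> u * g u)\<^sup>2)" .
  have d': "(\<Sum>u<n. \<Sum>v<n. R u v * \<psi> u * \<psi> v * (g v)\<^sup>2) = ?d"
    by (subst sum.swap) (auto intro!: sum.cong simp: sym)
  have "(\<Sum>u<n. \<Sum>v<n. - R u v * \<psi> u * \<psi> v * (g u - g v)\<^sup>2)
      = (\<Sum>u<n. \<Sum>v<n. 2 * (R u v * (\<psi> u * g u) * (\<psi> v * g v))
          - R u v * \<psi> u * \<psi> v * (g u)\<^sup>2 - R u v * \<psi> u * \<psi> v * (g v)\<^sup>2)"
    by (intro sum.cong refl) (simp add: power2_eq_square algebra_simps)
  also have "\<dots> = 2 * ?x - ?d - ?d"
    by (simp only: sum_subtractf d' sum_distrib_left)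
  finally show ?thesis using d by simp
qed

lemma sum_jumps_across_cut:
  fixes k :: "nat \<Rightarrow> nat \<Rightarrow> real"
  assumes sym: "\<And>u v. u < n \<Longrightarrow> v < n \<Longrightarrow> k u v = k v u" and S: "S \<subseteq> {..<n}"
    and g: "\<And>u. g u = (if u \<in> S then \<alpha> else \<beta>)"
  shows "(\<Sum>u<n. \<Sum>v<n. k u v * (g u - g v)\<^sup>2)
    = 2 * (\<alpha> - \<beta>)\<^sup>2 * (\<Sum>u\<in>S. \<Sum>v\<in>{..<n} - S. k u v)"
proof -
  let ?T = "{..<n} - S"
  let ?c = "\<Sum>u\<in>S. \<Sum>v\<in>?T. k u v"
  have split: "(\<Sum>v<n. f v) = (\<Sum>v\<in>S. f v) + (\<Sum>v\<in>?T. f v)" for f :: "nat \<Rightarrow> real"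
    using sum.subset_diff[OF S, of f] by simp
  have "(\<Sum>u\<in>S. \<Sum>v<n. k u v * (g u - g v)\<^sup>2) = (\<alpha> - \<beta>)\<^sup>2 * ?c"
    by (simp add: split g sum_distrib_left[symmetric] sum_distrib_right[symmetric] mult.commute)
  moreover have "(\<Sum>u\<in>?T. \<Sum>v<n. k u v * (g u - g v)\<^sup>2) = (\<alpha> - \<beta>)\<^sup>2 * (\<Sum>u\<in>?T. \<Sum>v\<in>S. k u v)"
    by (simp add: split g sum_distrib_left[symmetric] sum_distrib_right[symmetric] mult.commute
        power2_commute)
  moreover have "(\<Sum>u\<in>?T. \<Sum>v\<in>S. k u v) = ?c"
    using S by (subst sum.swap) (auto intro!: sum.cong sym)
  ultimately show ?thesis by (simp add: split)
qed

text \<open>The test function is \<open>\<psi> / a\<close> on \<open>S\<close> and \<open>- \<psi> / b\<close> off \<open>S\<close>.  The factors are chosen to make it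
orthogonal to \<open>\<psi>\<close>; its squared norm is then \<open>1 / a + 1 / b\<close>, and this number is also its jump
across the cut, relative to \<open>\<psi>\<close>.  The jump enters the quadratic form squared, so one factor
\<open>1 / a + 1 / b\<close> remains in the Rayleigh quotient.\<close>

lemma gap_le_cut:
  fixes R :: "nat \<Rightarrow> nat \<Rightarrow> real"
  assumes sym: "\<And>u v. u < n \<Longrightarrow> v < n \<Longrightarrow> R u v = R v u"
    and eig: "\<And>u. u < n \<Longrightarrow> (\<Sum>v<n. R u v * \<psi> v) = l\<^sub>0 * \<psi> u"
    and var: "\<And>f. (\<Sum>u<n. f u * \<psi> u) = 0 \<Longrightarrow>
        l\<^sub>1 * (\<Sum>u<n. (f u)\<^sup>2) \<le> (\<Sum>u<n. \<Sum>v<n. R u v * f u * f v)"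
    and S: "S \<subseteq> {..<n}"
    and a: "a = (\<Sum>u\<in>S. (\<psi> u)\<^sup>2)" "a > 0"
    and b: "b = (\<Sum>u\<in>{..<n} - S. (\<psi> u)\<^sup>2)" "b > 0"
  shows "l\<^sub>1 - l\<^sub>0 \<le> (1 / a + 1 / b) * (\<Sum>u\<in>S. \<Sum>v\<in>{..<n} - S. - R u v * \<psi> u * \<psi> v)"
proof -
  let ?T = "{..<n} - S"
  let ?cut = "\<Sum>u\<in>S. \<Sum>v\<in>?T. - R u v * \<psi> u * \<psi> v"
  define g where "g u = (if u \<in> S then 1 / a else - 1 / b)" for u
  have split: "(\<Sum>v<n. f v) = (\<Sum>v\<in>S. f v) + (\<Sum>v\<in>?T. f v)" for f :: "nat \<Rightarrow> real"
    using sum.subset_diff[OF S, of f] by simp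
  have "(\<Sum>u<n. \<psi> u * g u * \<psi> u) = (\<Sum>u\<in>S. (\<psi> u)\<^sup>2) / a - (\<Sum>u\<in>?T. (\<psi> u)\<^sup>2) / b"
    by (simp add: split g_def power2_eq_square sum_divide_distrib sum_negf)
  then have orth: "(\<Sum>u<n. \<psi> u * g u * \<psi> u) = 0" using a b by simp
  have "(\<Sum>u<n. (\<psi> u * g u)\<^sup>2) = (\<Sum>u\<in>S. (\<psi> u)\<^sup>2) / a\<^sup>2 + (\<Sum>u\<in>?T. (\<psi> u)\<^sup>2) / b\<^sup>2"
    by (simp add: split g_def power_mult_distrib power_divide sum_divide_distrib)
  then have norm: "(\<Sum>u<n. (\<psi> u * g u)\<^sup>2) = 1 / a + 1 / b"
    using a b by (simp add: power2_eq_square)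
  have gs: "(\<Sum>u<n. \<Sum>v<n. R u v * (\<psi> u * g u) * (\<psi> v * g v)) - l\<^sub>0 * (\<Sum>u<n. (\<psi> u * g u)\<^sup>2)
    = (\<Sum>u<n. \<Sum>v<n. - R u v * \<psi> u * \<psi> v * (g u - g v)\<^sup>2) / 2"
    by (rule ground_state_representation) (fact sym eig)+
  have "(l\<^sub>1 - l\<^sub>0) * (1 / a + 1 / b)
      \<le> (\<Sum>u<n. \<Sum>v<n. - R u v * \<psi> u * \<psi> v * (g u - g v)\<^sup>2) / 2"
    using var[OF orth] gs by (simp only: norm left_diff_distrib)
  also have "\<dots> = (1 / a - - 1 / b)\<^sup>2 * ?cut"
    using sum_jumps_across_cut[of n "\<lambda>u v. - R u v * \<psi> u * \<psi> v" S g "1 / a" "- 1 / b", OF _ S] 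
    by (simp add: g_def sym)
  also have "\<dots> = (1 / a + 1 / b) * ?cut * (1 / a + 1 / b)"
    by (simp add: power2_eq_square)
  finally show ?thesis
    by (rule mult_right_le_imp_le) (use a(2) b(2) in \<open>simp add: add_pos_pos\<close>)
qed

text \<open>Replacing \<open>1 / a + 1 / b\<close> by \<open>2 / min a b\<close> is legitimate only for \<open>c \<ge> 0\<close>.  For a cut through edges of
negative weight this sign is not obvious; it follows from \<open>\<gamma> \<ge> 0\<close>.\<close>

lemma le_twice_cheeger_quotient:
  fixes a b c :: real
  assumes "0 \<le> \<gamma>" and "\<gamma> \<le> (1 / a + 1 / b) * c" and "0 < a" "0 < b"
  shows "\<gamma> \<le> 2 * (c / min a b)"
proof -
  have "0 \<le> (1 / a + 1 / b) * c" "0 < 1 / a + 1 / b"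
    using assms by (auto intro: add_pos_pos)
  then have c: "0 \<le> c" by (simp add: zero_le_mult_iff)
  have "1 / a \<le> 1 / min a b" "1 / b \<le> 1 / min a b"
    using assms by (auto intro!: divide_left_mono)
  then have "(1 / a + 1 / b) * c \<le> (2 * (1 / min a b)) * c"
    using c by (intro mult_right_mono) auto
  then show ?thesis using assms by simp
qed

section \<open>Passing to the moduli of the ground state\<close>

lemma phase_unimodular: "cnj (phase z) * phase z = 1"
proof -
  have "cmod (phase z) = 1" by (simp add: phase_def norm_divide)
  then show ?thesis by (simp add: mult.commute flip: complex_norm_square)
qed

lemma phase_times_cmod: "phase z * complex_of_real (cmod z) = z"
  by (simp add: phase_def)

lemma phase_conjugation_index:
  assumes H: "H \<in> carrier_mat n n" and U: "U = phase_mat n \<phi>" and "i < n" "j < n"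
  shows "(mat_adjoint U * H * U) $$ (i, j) = cnj (phase (\<phi> $ i)) * H $$ (i, j) * phase (\<phi> $ j)"
proof -
  have "mat_adjoint U = mat_diag n (\<lambda>i. cnj (phase (\<phi> $ i)))"
    unfolding U phase_mat_def
    by (intro eq_matI) (auto simp: mat_adjoint_index mat_diag_def)
  then show ?thesis
    using assms by (simp add: phase_mat_def mat_diag_mult_left[OF H] mat_diag_mult_right[of _ n n])
qed

text \<open>For both kinds, the volume of a set is the squared norm of the ground state on it.\<close>

lemma vertex_weight_scaled_modulus:
  assumes "kind = Normalized \<Longrightarrow> wdegree n w u > 0"
  shows "vertex_weight kind n w u * (scaled_modulus kind n w \<phi> u)\<^sup>2 = (cmod (\<phi> $ u))\<^sup>2"
  using assms by (cases kind) (auto simp: power_divide)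

text \<open>The scaling of the ground state by \<open>1 / sqrt (wdegree n w u)\<close> in the normalized case absorbs the
denominators of the normalized Laplacian, so that both kinds give the same cut weights.\<close>

lemma laplacian_scaled_modulus:
  assumes "u < n" "v < n" "u \<noteq> v"
    and "kind = Normalized \<Longrightarrow> wdegree n w u > 0 \<and> wdegree n w v > 0"
  shows "- laplacian kind n w $$ (u, v) * cmod (\<phi> $ u) * cmod (\<phi> $ v)
    = w u v * scaled_modulus kind n w \<phi> u * scaled_modulus kind n w \<phi> v"
  using assms by (cases kind) (auto simp: real_sqrt_mult)

theorem mainTheorem2:
  fixes n :: nat
    and H U :: "complex mat"
    and lam :: "nat \<Rightarrow> real"
    and \<phi>\<^sub>0 :: "complex vec"
    and kind :: laplacian_kind
    and E :: "nat set set"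
    and w :: "nat \<Rightarrow> nat \<Rightarrow> real"
    and W :: "real mat"
    and h :: ereal
    and \<gamma> :: real
  assumes "n \<ge> 2"
    and "H \<in> carrier_mat n n"
    and "hermitian_mat H"
    and "ordered_eigenvalues n H lam"
    and "\<gamma> = lam 1 - lam 0"
    and "eigenvector H \<phi>\<^sub>0 (complex_of_real (lam 0))"
    and "U = phase_mat n \<phi>\<^sub>0"
    and "connected_weighted_graph n E w"
    and "kind = Normalized \<Longrightarrow> \<forall>u<n. wdegree n w u > 0"
    and "W \<in> carrier_mat n n"
    and "diagonal_mat W"
    and "map_mat Re (mat_adjoint U * H * U) = laplacian kind n w + W"
    and "h = cheeger n w (vertex_weight kind n w) (scaled_modulus kind n w \<phi>\<^sub>0)"
  shows "2 * h \<ge> ereal \<gamma>"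
proof -
  note H = assms(2) and herm = assms(3)
  define p where "p u = phase (\<phi>\<^sub>0 $ u)" for u
  define \<psi> where "\<psi> u = cmod (\<phi>\<^sub>0 $ u)" for u
  \<comment> \<open>the real part of the conjugated matrix, whose ground state is \<open>\<psi>\<close>\<close>
  define R where "R u v = Re (cnj (p u) * H $$ (u, v) * p v)" for u v
  have \<phi>: "\<phi>\<^sub>0 \<in> carrier_vec n" and ev: "H *\<^sub>v \<phi>\<^sub>0 = complex_of_real (lam 0) \<cdot>\<^sub>v \<phi>\<^sub>0"
    using assms(2,6) unfolding eigenvector_def by auto
  have re_scale: "Re (z * of_real r) = Re z * r" for z r by simp
  have p1: "cnj (p u) * p u = 1" for u unfolding p_def by (rule phase_unimodular)
  have p\<psi>: "\<phi>\<^sub>0 $ u = p u * of_real (\<psi> u)" for u by (simp add: p_def \<psi>_def phase_times_cmod)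
  have U: "(mat_adjoint U * H * U) $$ (u, v) = cnj (p u) * H $$ (u, v) * p v"
    if "u < n" "v < n" for u v
    unfolding p_def by (rule phase_conjugation_index[OF H assms(7) that])
  have sym: "R u v = R v u" if "u < n" "v < n" for u v
    using hermitian_mat_index[OF H herm that] by (simp add: R_def algebra_simps)
  have eig: "(\<Sum>v<n. R u v * \<psi> v) = lam 0 * \<psi> u" if u: "u < n" for u
  proof -
    have "(\<Sum>v<n. H $$ (u, v) * \<phi>\<^sub>0 $ v) = of_real (lam 0) * \<phi>\<^sub>0 $ u"
      using mult_mat_vec_sum[OF H \<phi> u] \<phi> u by (simp add: ev)
    then have "(\<Sum>v<n. cnj (p u) * H $$ (u, v) * p v * of_real (\<psi> v))
        = of_real (lam 0) * (cnj (p u) * p u) * of_real (\<psi> u)"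
      unfolding p\<psi> by (simp add: sum_distrib_left[symmetric] mult.assoc mult.left_commute[of _ "cnj (p u)"])
    then have "Re (\<Sum>v<n. cnj (p u) * H $$ (u, v) * p v * of_real (\<psi> v)) = lam 0 * \<psi> u"
      by (simp add: p1)
    then show ?thesis by (simp add: R_def)
  qed
  have var: "lam 1 * (\<Sum>u<n. (f u)\<^sup>2) \<le> (\<Sum>u<n. \<Sum>v<n. R u v * f u * f v)"
    if orth: "(\<Sum>u<n. f u * \<psi> u) = 0" for f
  proof -
    \<comment> \<open>undoing the conjugation: \<open>x\<close> is \<open>U\<close> applied to \<open>f\<close>, so that \<open>H\<close> itself can be used\<close>
    define x where "x = vec n (\<lambda>u. p u * of_real (f u))"
    have x: "x \<in> carrier_vec n" by (simp add: x_def)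
    have "x \<bullet>c \<phi>\<^sub>0 = (\<Sum>u<n. (cnj (p u) * p u) * of_real (f u * \<psi> u))"
      unfolding cscalar_prod_sum[OF x \<phi>] p\<psi> by (intro sum.cong) (auto simp: x_def)
    also have "\<dots> = of_real (\<Sum>u<n. f u * \<psi> u)" by (simp add: p1)
    finally have "x \<bullet>c \<phi>\<^sub>0 = 0" by (simp add: orth)
    from hermitian_form_ge_second_eigenvalue[OF H herm assms(4,6,1) x this]
    have "lam 1 * Re (x \<bullet>c x) \<le> Re ((H *\<^sub>v x) \<bullet>c x)" .
    moreover have "x \<bullet>c x = (\<Sum>u<n. (cnj (p u) * p u) * of_real ((f u)\<^sup>2))"
      unfolding cscalar_prod_sum[OF x x] by (intro sum.cong) (auto simp: x_def power2_eq_square)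
    moreover have "(H *\<^sub>v x) \<bullet>c x
        = (\<Sum>u<n. \<Sum>v<n. cnj (p u) * H $$ (u, v) * p v * of_real (f u * f v))"
      unfolding quadratic_form_sum[OF H x] by (intro sum.cong refl) (auto simp: x_def)
    moreover have "R u v * f u * f v = Re (cnj (p u) * H $$ (u, v) * p v * of_real (f u * f v))" for u v
      unfolding R_def re_scale by (rule mult.assoc)
    ultimately show ?thesis by (simp only: p1 mult_1 Re_sum Re_complex_of_real)
  qed
  have "0 \<le> \<gamma>"
    using assms(1,4,5) mono_onD[of "{..<n}" lam 0 1] unfolding ordered_eigenvalues_def by simp
  have quot: "ereal \<gamma> \<le> 2 * ereal (boundary n w (scaled_modulus kind n w \<phi>\<^sub>0) S / min a b)"
    if S: "S \<subseteq> {..<n}"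
      and a: "a = vol (vertex_weight kind n w) (scaled_modulus kind n w \<phi>\<^sub>0) S" "a > 0"
      and b: "b = vol (vertex_weight kind n w) (scaled_modulus kind n w \<phi>\<^sub>0) ({..<n} - S)" "b > 0"
    for S a b
  proof -
    have a': "a = (\<Sum>u\<in>S. (\<psi> u)\<^sup>2)" and b': "b = (\<Sum>u\<in>{..<n} - S. (\<psi> u)\<^sup>2)"
      unfolding a b vol_def \<psi>_def using S assms(9)
      by (auto intro!: sum.cong vertex_weight_scaled_modulus)
    have "- R u v * \<psi> u * \<psi> v
        = w u v * scaled_modulus kind n w \<phi>\<^sub>0 u * scaled_modulus kind n w \<phi>\<^sub>0 v"
      if "u \<in> S" "v \<in> {..<n} - S" for u v
    proof -
      have uv: "u < n" "v < n" "u \<noteq> v" using that S by auto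
      have "dim_row (mat_adjoint U * H * U) = n" "dim_col (mat_adjoint U * H * U) = n"
        using assms(2,7) by (auto simp: phase_mat_def mat_diag_def)
      then have "R u v = map_mat Re (mat_adjoint U * H * U) $$ (u, v)"
        using uv by (simp add: R_def U del: index_mult_mat)
      also have "\<dots> = laplacian kind n w $$ (u, v)"
        using assms(10,11) uv carrier_matD[OF assms(10)]
        unfolding assms(12) by (simp add: diagonal_mat_def)
      finally show ?thesis
        using laplacian_scaled_modulus[OF uv, of kind w \<phi>\<^sub>0] assms(9) uv by (simp add: \<psi>_def)
    qed
    then have cut: "(\<Sum>u\<in>S. \<Sum>v\<in>{..<n} - S. - R u v * \<psi> u * \<psi> v)
        = boundary n w (scaled_modulus kind n w \<phi>\<^sub>0) S"
      unfolding boundary_def by (intro sum.cong refl)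
    have "\<gamma> \<le> (1 / a + 1 / b) * boundary n w (scaled_modulus kind n w \<phi>\<^sub>0) S"
      using gap_le_cut[OF sym eig var S a' a(2) b' b(2)] unfolding cut assms(5) .
    from le_twice_cheeger_quotient[OF \<open>0 \<le> \<gamma>\<close> this a(2) b(2)] show ?thesis
      by simp
  qed
  have "ereal (\<gamma> / 2) \<le> h"
    unfolding assms(13) cheeger_def
  proof (rule INF_greatest)
    fix S assume "S \<in> {S. S \<subseteq> {..<n} \<and> 0 < vol (vertex_weight kind n w) (scaled_modulus kind n w \<phi>\<^sub>0) S \<and>
      0 < vol (vertex_weight kind n w) (scaled_modulus kind n w \<phi>\<^sub>0) ({..<n} - S)}"
    then show "ereal (\<gamma> / 2) \<le> ereal (boundary n w (scaled_modulus kind n w \<phi>\<^sub>0) S /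
        min (vol (vertex_weight kind n w) (scaled_modulus kind n w \<phi>\<^sub>0) S)
          (vol (vertex_weight kind n w) (scaled_modulus kind n w \<phi>\<^sub>0) ({..<n} - S)))"
      using quot[OF _ refl _ refl, of S] by (simp add: mult.commute)
  qed
  then have "2 * ereal (\<gamma> / 2) \<le> 2 * h" by (intro ereal_mult_left_mono) auto
  then show ?thesis by simp
qed

end
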